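(* The asymptotic $\delta$-record probability $p_\delta(c)$ in the linear drift model, as a function of $c\in\mathbb{R}$ and $\delta\in\mathbb{R}$, satisfies: (a) for all $\delta\in\mathbb{R}$, the function $c\mapsto p_\delta(c)$ is continuous at every $c\ne0$ and right-continuous at $c=0$; (b) for $\delta\in\mathbb{R}$, the function $c\mapsto p_\delta(c)$ is discontinuous at $c=0$ if and only if $x_+<\infty$ and $\delta<0$; (c) for all $c\in\mathbb{R}$, the function $\delta\mapsto p_\delta(c)$ is continuous on $\mathbb{R}$.
   Context: Linear drift model: $Y_n=X_n+cn$, $n\ge1$, where $c\in\mathbb{R}$ and $(X_n)_{n\ge1}$ are iid real random variables with absolutely continuous cdf $F$ and pdf $f$. It is assumed that there are $-\infty\le x_-<x_+\le\infty$ such that $f(x)>0$ for all $x\in(x_-,x_+)$ and $f(x)=0$ otherwise; so $x_-=\inf\{x:F(x)>0\}$ and $x_+=\sup\{x:F(x)<1\}$. For $\delta\in\mathbb{R}$, $Y_1$ is by convention a $\delta$-record, and for $j\ge2$, $Y_j$ is a $\delta$-record if $Y_j>\max\{Y_1,\dots,Y_{j-1}\}+\delta$. The probability that $Y_j$ is a $\delta$-record is $p_{j,\delta}(c)=\int_{-\infty}^\infty\prod_{i=1}^{j-1}F(x+ci-\delta)f(x)\,dx$, and the asymptotic $\delta$-record probability is $$p_\delta(c)=\lim_{n\to\infty}p_{n,\delta}(c)=\int_{-\infty}^\infty\prod_{i=1}^{\infty}F(x+ci-\delta)f(x)\,dx,$$ where the infinite product is the limit of the nonincreasing partial products. *)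

theory Defs
  imports "HOL-Probability.Probability"
begin

text \<open>
  Sequences are indexed from 1, as is customary for records; the value at index 0 is never used.
  The endpoints of the support may be infinite, hence their type \<^typ>\<open>ereal\<close>.
\<close>

locale linear_drift_model = prob_space M
  for M :: "'a measure"
    and X :: "nat \<Rightarrow> 'a \<Rightarrow> real"
    and f :: "real \<Rightarrow> real"
    and x_minus x_plus :: ereal +
  assumes indep: "indep_vars (\<lambda>_. borel) X {1..}"
    and density: "\<And>n. n \<ge> 1 \<Longrightarrow> distributed M lborel (X n) (\<lambda>x. ennreal (f x))"
    and endpoints: "x_minus < x_plus"
    and f_pos: "\<And>x. x_minus < ereal x \<Longrightarrow> ereal x < x_plus \<Longrightarrow> f x > 0"
    and f_zero: "\<And>x. \<not> (x_minus < ereal x \<and> ereal x < x_plus) \<Longrightarrow> f x = 0"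

definition drifted :: "(nat \<Rightarrow> 'a \<Rightarrow> real) \<Rightarrow> real \<Rightarrow> nat \<Rightarrow> 'a \<Rightarrow> real" where
  "drifted X c n \<omega> = X n \<omega> + c * real n"

definition is_delta_record :: "real \<Rightarrow> (nat \<Rightarrow> real) \<Rightarrow> nat \<Rightarrow> bool" where
  "is_delta_record \<delta> y j \<longleftrightarrow> j = 1 \<or> (j \<ge> 2 \<and> y j > Max (y ` {1..<j}) + \<delta>)"

definition delta_record_prob ::
    "'a measure \<Rightarrow> (nat \<Rightarrow> 'a \<Rightarrow> real) \<Rightarrow> nat \<Rightarrow> real \<Rightarrow> real \<Rightarrow> real" where
  "delta_record_prob M X j \<delta> c =
     \<P>(\<omega> in M. is_delta_record \<delta> (\<lambda>n. drifted X c n \<omega>) j)"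

text \<open>
  The limit exists in every linear drift model and equals the familiar integral of an infinite
  product of distribution functions; both facts are shown at the end of this theory.
\<close>

definition asymptotic_delta_record_prob ::
    "'a measure \<Rightarrow> (nat \<Rightarrow> 'a \<Rightarrow> real) \<Rightarrow> real \<Rightarrow> real \<Rightarrow> real" where
  "asymptotic_delta_record_prob M X \<delta> c = lim (\<lambda>n. delta_record_prob M X n \<delta> c)"

context linear_drift_model
begin

definition F :: "real \<Rightarrow> real" where
  "F = cdf (distr M borel (X 1))"

lemma f_nonneg: "f x \<ge> 0"
  using f_pos[of x] f_zero[of x] by force

lemma X_measurable: "n \<ge> 1 \<Longrightarrow> random_variable borel (X n)"
  using density[of n] by (simp add: distributed_def)

lemma f_measurable [measurable]: "f \<in> borel_measurable borel"
  using distributed_real_measurable[OF _ density[of 1]] f_nonneg by simp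

lemma distr_X: "n \<ge> 1 \<Longrightarrow> distr M borel (X n) = density lborel (\<lambda>x. ennreal (f x))"
  using distributed_distr_eq_density[OF density[of n]]
    distr_cong[OF refl sets_lborel[symmetric], of M "X n" "X n"] by simp

lemma F_eq: "F = cdf (density lborel (\<lambda>x. ennreal (f x)))"
  unfolding F_def by (simp add: distr_X)

sublocale D: real_distribution "density lborel (\<lambda>x. ennreal (f x))"
proof -
  have "prob_space (distr M borel (X 1))"
    by (rule prob_space_distr) (simp add: X_measurable)
  then show "real_distribution (density lborel (\<lambda>x. ennreal (f x)))"
    by (simp add: distr_X real_distribution_def real_distribution_axioms_def)
qed

lemma f_integrable: "integrable lborel f"
proof -
  have "(\<integral>\<^sup>+x. ennreal (f x) \<partial>lborel) = 1"
    using D.emeasure_space_1 by (simp add: emeasure_density)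
  then show ?thesis
    by (intro integrableI_nonneg) (auto simp: f_nonneg)
qed

lemma emeasure_D_lessThan: "emeasure (density lborel (\<lambda>x. ennreal (f x))) {..<a} = ennreal (F a)"
proof -
  have "(\<integral>\<^sup>+x. ennreal (f x) * indicator {..<a} x \<partial>lborel)
      = (\<integral>\<^sup>+x. ennreal (f x) * indicator {..a} x \<partial>lborel)"
  proof (rule nn_integral_cong_AE)
    show "AE x in lborel. ennreal (f x) * indicator {..<a} x = ennreal (f x) * indicator {..a} x"
      using AE_lborel_singleton[of a] by eventually_elim (simp add: indicator_def)
  qed
  then have "emeasure (density lborel (\<lambda>x. ennreal (f x))) {..<a}
      = emeasure (density lborel (\<lambda>x. ennreal (f x))) {..a}"
    by (simp add: emeasure_density)
  then show ?thesis
    by (simp add: F_eq cdf_def D.emeasure_eq_measure)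
qed

lemma F_bounds: "0 \<le> F x" "F x \<le> 1"
  unfolding F_eq by (simp_all add: D.cdf_nonneg D.cdf_bounded_prob)

lemma F_measurable [measurable]: "F \<in> borel_measurable borel"
  unfolding F_eq by (intro borel_measurable_mono monoI D.cdf_nondecreasing)

lemma delta_record_prob_eq:
  assumes "j \<ge> 1"
  shows "delta_record_prob M X j \<delta> c = (\<integral>x. (\<Prod>i=1..<j. F (x + c * real i - \<delta>)) * f x \<partial>lborel)"
proof -
  let ?D = "density lborel (\<lambda>x. ennreal (f x))"
  let ?I = "{1..<j}" and ?J = "insert j {1..<j}"
  let ?R = "\<lambda>y::nat \<Rightarrow> real. \<forall>i\<in>?I. y i < y j + c * real (j - i) - \<delta>"
  let ?S = "{y \<in> space (Pi\<^sub>M ?J (\<lambda>_. borel)). ?R y}"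
  interpret P: product_sigma_finite "\<lambda>_::nat. ?D"
    by (simp add: product_sigma_finite_def D.sigma_finite_measure_axioms)
  have rec: "is_delta_record \<delta> (\<lambda>n. drifted X c n \<omega>) j \<longleftrightarrow> ?R (\<lambda>i. X i \<omega>)" for \<omega>
  proof (cases "j = 1")
    case False
    with assms have "?I \<noteq> {}" "j \<ge> 2" by auto
    have "is_delta_record \<delta> (\<lambda>n. drifted X c n \<omega>) j \<longleftrightarrow>
        Max ((\<lambda>n. drifted X c n \<omega>) ` ?I) < drifted X c j \<omega> - \<delta>"
      unfolding is_delta_record_def using False \<open>j \<ge> 2\<close> by linarith
    also have "\<dots> \<longleftrightarrow> (\<forall>i\<in>?I. drifted X c i \<omega> < drifted X c j \<omega> - \<delta>)"
      using \<open>?I \<noteq> {}\<close> by (subst Max_less_iff) auto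
    also have "\<dots> \<longleftrightarrow> ?R (\<lambda>i. X i \<omega>)"
      by (intro ball_cong refl) (auto simp: drifted_def of_nat_diff algebra_simps)
    finally show ?thesis .
  qed (simp add: is_delta_record_def)
  have indepJ: "indep_vars (\<lambda>_. borel) X ?J"
    using indep by (rule indep_vars_subset) (use assms in auto)
  have rv: "i \<in> ?J \<Longrightarrow> random_variable borel (X i)" for i
    using assms X_measurable[of i] by auto
  have joint: "distr M (Pi\<^sub>M ?J (\<lambda>_. borel)) (\<lambda>\<omega>. \<lambda>i\<in>?J. X i \<omega>) = Pi\<^sub>M ?J (\<lambda>_. ?D)"
  proof -
    have "distr M (Pi\<^sub>M ?J (\<lambda>_. borel)) (\<lambda>\<omega>. \<lambda>i\<in>?J. X i \<omega>)
        = Pi\<^sub>M ?J (\<lambda>i. distr M borel (X i))"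
      using indepJ by (subst (asm) indep_vars_iff_distr_eq_PiM') (auto intro: rv)
    also have "\<dots> = Pi\<^sub>M ?J (\<lambda>_. ?D)"
      by (intro PiM_cong refl distr_X) (use assms in auto)
    finally show ?thesis .
  qed
  have S[measurable]: "?S \<in> sets (Pi\<^sub>M ?J (\<lambda>_. borel))"
    by measurable
  have sets_eq: "sets (Pi\<^sub>M ?J (\<lambda>_. ?D)) = sets (Pi\<^sub>M ?J (\<lambda>_. borel))"
    by (intro sets_PiM_cong) auto
  have meas: "(\<lambda>\<omega>. \<lambda>i\<in>?J. X i \<omega>) \<in> M \<rightarrow>\<^sub>M Pi\<^sub>M ?J (\<lambda>_. borel)"
    by (intro measurable_restrict rv)
  have "ennreal (delta_record_prob M X j \<delta> c) = emeasure M {\<omega>\<in>space M. ?R (\<lambda>i. X i \<omega>)}"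
    by (simp add: delta_record_prob_def rec emeasure_eq_measure)
  also have "{\<omega>\<in>space M. ?R (\<lambda>i. X i \<omega>)} = (\<lambda>\<omega>. \<lambda>i\<in>?J. X i \<omega>) -` ?S \<inter> space M"
    using assms by (auto simp: space_PiM)
  also have "emeasure M \<dots> = emeasure (Pi\<^sub>M ?J (\<lambda>_. ?D)) ?S"
    using meas S by (subst joint[symmetric], subst emeasure_distr) auto
  also have "\<dots> = (\<integral>\<^sup>+y. indicator ?S y \<partial>Pi\<^sub>M ?J (\<lambda>_. ?D))"
    using S sets_eq by (subst nn_integral_indicator) auto
  also have "\<dots> = (\<integral>\<^sup>+x. \<integral>\<^sup>+y. indicator ?S (y(j := x)) \<partial>Pi\<^sub>M ?I (\<lambda>_. ?D) \<partial>?D)"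
    using S sets_eq by (subst P.product_nn_integral_insert_rev) auto
  also have "\<dots> = (\<integral>\<^sup>+x. ennreal (\<Prod>i\<in>?I. F (x + c * real (j - i) - \<delta>)) \<partial>?D)"
  proof (intro nn_integral_cong)
    fix x
    let ?B = "Pi\<^sub>E ?I (\<lambda>i. {..<x + c * real (j - i) - \<delta>})"
    have "(\<integral>\<^sup>+y. indicator ?S (y(j := x)) \<partial>Pi\<^sub>M ?I (\<lambda>_. ?D)) = (\<integral>\<^sup>+y. indicator ?B y \<partial>Pi\<^sub>M ?I (\<lambda>_. ?D))"
    proof (intro nn_integral_cong)
      fix y assume "y \<in> space (Pi\<^sub>M ?I (\<lambda>_. ?D))"
      then have "y \<in> extensional ?I" by (simp add: space_PiM PiE_def)
      then have "y(j := x) \<in> ?S \<longleftrightarrow> y \<in> ?B"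
        by (auto simp: space_PiM PiE_iff extensional_def split: if_splits)
      then show "indicator ?S (y(j := x)) = (indicator ?B y :: ennreal)"
        by (simp only: indicator_def)
    qed
    also have "\<dots> = emeasure (Pi\<^sub>M ?I (\<lambda>_. ?D)) ?B"
      by (intro nn_integral_indicator sets_PiM_I_finite) auto
    also have "\<dots> = (\<Prod>i\<in>?I. ennreal (F (x + c * real (j - i) - \<delta>)))"
      by (subst P.emeasure_PiM) (auto simp: emeasure_D_lessThan)
    also have "\<dots> = ennreal (\<Prod>i\<in>?I. F (x + c * real (j - i) - \<delta>))"
      by (rule prod_ennreal) (simp add: F_bounds)
    finally show "(\<integral>\<^sup>+y. indicator ?S (y(j := x)) \<partial>Pi\<^sub>M ?I (\<lambda>_. ?D))
        = ennreal (\<Prod>i\<in>?I. F (x + c * real (j - i) - \<delta>))" .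
  qed
  also have "\<dots> = (\<integral>\<^sup>+x. ennreal (\<Prod>i\<in>?I. F (x + c * real i - \<delta>)) \<partial>?D)"
  proof -
    have "(\<Prod>i\<in>?I. F (x + c * real (j - i) - \<delta>)) = (\<Prod>i\<in>?I. F (x + c * real i - \<delta>))" for x
      by (rule prod.reindex_bij_witness[of _ "\<lambda>i. j - i" "\<lambda>i. j - i"]) auto
    then show ?thesis by simp
  qed
  also have "\<dots> = (\<integral>\<^sup>+x. ennreal ((\<Prod>i\<in>?I. F (x + c * real i - \<delta>)) * f x) \<partial>lborel)"
    by (subst nn_integral_density)
       (auto intro!: nn_integral_cong simp: ennreal_mult' f_nonneg mult.commute)
  finally have *: "(\<integral>\<^sup>+x. ennreal ((\<Prod>i\<in>?I. F (x + c * real i - \<delta>)) * f x) \<partial>lborel)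
      = ennreal (delta_record_prob M X j \<delta> c)" by simp
  have "(\<integral>x. (\<Prod>i\<in>?I. F (x + c * real i - \<delta>)) * f x \<partial>lborel)
      = enn2real (\<integral>\<^sup>+x. ennreal ((\<Prod>i\<in>?I. F (x + c * real i - \<delta>)) * f x) \<partial>lborel)"
    by (rule integral_eq_nn_integral) (auto simp: F_bounds f_nonneg intro!: prod_nonneg mult_nonneg_nonneg)
  with * show ?thesis
    by (simp add: delta_record_prob_def)
qed

text \<open>
  The infinite product is the limit of its partial products, which may be 0 although no factor
  vanishes; \<^const>\<open>prodinf\<close> is not suitable here because it treats such products as divergent.
\<close>

definition F_prod :: "real \<Rightarrow> real \<Rightarrow> real \<Rightarrow> real" where
  "F_prod \<delta> c x = lim (\<lambda>n. \<Prod>i=1..n. F (x + c * real i - \<delta>))"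

lemma F_prod_LIMSEQ: "(\<lambda>n. \<Prod>i=1..n. F (x + c * real i - \<delta>)) \<longlonglongrightarrow> F_prod \<delta> c x"
proof -
  have "decseq (\<lambda>n. \<Prod>i=1..n. F (x + c * real i - \<delta>))"
    by (rule decseq_SucI)
       (auto simp: F_bounds prod.nat_ivl_Suc' intro!: mult_right_le_one_le prod_nonneg)
  then obtain L where "(\<lambda>n. \<Prod>i=1..n. F (x + c * real i - \<delta>)) \<longlonglongrightarrow> L"
    by (rule decseq_convergent[of _ 0]) (auto simp: F_bounds intro!: prod_nonneg)
  then show ?thesis
    unfolding F_prod_def using convergent_LIMSEQ_iff convergent_def by blast
qed

lemma delta_record_prob_LIMSEQ:
  "(\<lambda>n. delta_record_prob M X n \<delta> c) \<longlonglongrightarrow> (\<integral>x. F_prod \<delta> c x * f x \<partial>lborel)"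
proof -
  have [measurable]: "F_prod \<delta> c \<in> borel_measurable borel"
    by (rule borel_measurable_LIMSEQ_real[OF F_prod_LIMSEQ]) measurable
  have "(\<lambda>n. \<integral>x. (\<Prod>i=1..n. F (x + c * real i - \<delta>)) * f x \<partial>lborel)
      \<longlonglongrightarrow> (\<integral>x. F_prod \<delta> c x * f x \<partial>lborel)"
  proof (rule integral_dominated_convergence[where w = f])
    fix n
    have "norm ((\<Prod>i=1..n. F (x + c * real i - \<delta>)) * f x) \<le> f x" for x
      by (auto simp: abs_mult f_nonneg F_bounds abs_prod
            intro!: mult_left_le_one_le prod_nonneg prod_le_1)
    then show "AE x in lborel. norm ((\<Prod>i=1..n. F (x + c * real i - \<delta>)) * f x) \<le> f x"
      by simp
    show "AE x in lborel. (\<lambda>n. (\<Prod>i=1..n. F (x + c * real i - \<delta>)) * f x)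
        \<longlonglongrightarrow> F_prod \<delta> c x * f x"
      by (intro AE_I2 tendsto_mult F_prod_LIMSEQ tendsto_const)
  qed (simp_all add: f_integrable)
  then have "(\<lambda>n. delta_record_prob M X (Suc n) \<delta> c) \<longlonglongrightarrow> (\<integral>x. F_prod \<delta> c x * f x \<partial>lborel)"
    by (simp add: delta_record_prob_eq atLeastLessThanSuc_atLeastAtMost)
  then show ?thesis
    by (rule LIMSEQ_imp_Suc)
qed

lemma asymptotic_delta_record_prob_eq:
  "asymptotic_delta_record_prob M X \<delta> c = (\<integral>x. F_prod \<delta> c x * f x \<partial>lborel)"
  unfolding asymptotic_delta_record_prob_def
  by (rule limI) (rule delta_record_prob_LIMSEQ)

end

end

theory Submission
  imports Defs "HOL-Real_Asymp.Real_Asymp"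
begin

text \<open>
  The product \<open>F_prod \<delta> c x\<close> increases with \<open>c\<close> and with \<open>x - \<delta>\<close>, and as an infimum of continuous
  functions it is upper semicontinuous; hence it is right-continuous in \<open>c\<close> everywhere. For \<open>c > 0\<close>
  it is also lower semicontinuous in \<open>c\<close>: the product of the factors beyond index \<open>N\<close> is, for
  all \<open>c' > c / 2\<close>, at least the corresponding tail for the drift \<open>c / 2\<close>. Splitting that product
  into even and odd indices turns it into two products for the drift \<open>c\<close>, so that its tail tends
  to 1 unless the product vanishes already. A monotone function has only countably many
  discontinuities, which gives continuity in \<open>\<delta>\<close> for almost every \<open>x\<close>. All claims about
  continuity of the integral follow by dominated convergence. For \<open>c < 0\<close> the product is 0, and for
  \<open>c = 0\<close> it is the indicator of \<open>x - \<delta> \<ge> x_plus\<close>, so at \<open>c = 0\<close> continuity fails exactly if the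
  latter event has positive probability.
\<close>

text \<open>A nonempty open interval with extended endpoints contains one with real endpoints, which
  has positive Lebesgue measure. This turns almost-everywhere statements about \<open>f\<close> into
  inequalities between endpoints.\<close>

lemma not_AE_lborel_outside_interval:
  fixes a b :: ereal
  assumes "a < b"
  shows "\<not> (AE x in lborel. \<not> (a < ereal x \<and> ereal x < b))"
proof
  assume AE: "AE x in lborel. \<not> (a < ereal x \<and> ereal x < b)"
  obtain r where r: "a < ereal r" "ereal r < b"
    using ereal_dense2[OF assms] by auto
  obtain s where s: "ereal r < ereal s" "ereal s < b"
    using ereal_dense2[OF r(2)] by auto
  have "AE x in lborel. x \<notin> {r<..<s}"
    using AE
  proof eventually_elim
    case (elim x)
    then show ?case
      using r s order.strict_trans[of a "ereal r" "ereal x"]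
        order.strict_trans[of "ereal x" "ereal s" b] by auto
  qed
  then have "emeasure lborel {r<..<s} = 0"
    by (subst (asm) AE_iff_measurable[of "{r<..<s}"]) auto
  then show False
    using s by simp
qed

context linear_drift_model
begin

section \<open>The distribution function\<close>

lemma F_mono: "x \<le> y \<Longrightarrow> F x \<le> F y"
  unfolding F_eq by (rule D.cdf_nondecreasing)

lemma isCont_F: "isCont F x"
proof -
  have "AE y in lborel. ennreal (f y) * indicator {x} y = 0"
    using AE_lborel_singleton[of x] by eventually_elim simp
  then have "(\<integral>\<^sup>+y. ennreal (f y) * indicator {x} y \<partial>lborel) = 0"
    by (subst nn_integral_0_iff_AE) simp_all
  then have "emeasure (density lborel (\<lambda>x. ennreal (f x))) {x} = 0"
    by (simp add: emeasure_density)
  then show ?thesis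
    unfolding F_eq D.isCont_cdf by (simp add: measure_def)
qed

lemma continuous_F [continuous_intros]:
  "continuous (at a within A) g \<Longrightarrow> continuous (at a within A) (\<lambda>u. F (g u))"
  by (rule continuous_within_compose3[OF isCont_F])

text \<open>\<open>F y = 1\<close> says that \<open>f\<close> vanishes almost everywhere above
  \<open>y\<close>; as \<open>f\<close> is positive throughout its support, the part of the support
  above \<open>y\<close> must be empty.\<close>

lemma F_eq_1_iff: "F y = 1 \<longleftrightarrow> x_plus \<le> ereal y"
proof -
  have "F y = 1 \<longleftrightarrow> D.prob {y<..} = 0"
    using D.prob_compl[of "{..y}"] by (auto simp: F_eq cdf_def Compl_eq_Diff_UNIV[symmetric])
  also have "\<dots> \<longleftrightarrow> emeasure (density lborel (\<lambda>x. ennreal (f x))) {y<..} = 0"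
    by (simp add: D.emeasure_eq_measure)
  also have "\<dots> \<longleftrightarrow> (AE x in lborel. \<not> (y < x \<and> f x \<noteq> 0))"
    using f_nonneg by (subst emeasure_density) (auto simp: nn_integral_0_iff_AE indicator_def not_less
        intro!: AE_cong antisym)
  also have "\<dots> \<longleftrightarrow> (AE x in lborel. \<not> (max (ereal y) x_minus < ereal x \<and> ereal x < x_plus))"
    using f_pos f_zero by (intro AE_cong) force
  also have "\<dots> \<longleftrightarrow> x_plus \<le> ereal y"
  proof
    assume "AE x in lborel. \<not> (max (ereal y) x_minus < ereal x \<and> ereal x < x_plus)"
    then show "x_plus \<le> ereal y"
      using not_AE_lborel_outside_interval[of "max (ereal y) x_minus" x_plus] endpoints by force
  qed (auto intro!: AE_I2 dest: order.strict_trans2)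
  finally show ?thesis .
qed

section \<open>Bounds, monotonicity and factorizations of the infinite product\<close>

lemma partial_prod_bounds:
  "0 \<le> (\<Prod>i=1..n. F (x + c * real i - \<delta>))" "(\<Prod>i=1..n. F (x + c * real i - \<delta>)) \<le> 1"
  by (auto intro!: prod_nonneg prod_le_1 simp: F_bounds)

lemma F_prod_le_partial: "F_prod \<delta> c x \<le> (\<Prod>i=1..n. F (x + c * real i - \<delta>))"
proof (rule decseq_ge[OF _ F_prod_LIMSEQ])
  show "decseq (\<lambda>n. \<Prod>i=1..n. F (x + c * real i - \<delta>))"
    by (rule decseq_SucI)
       (auto simp: F_bounds prod.nat_ivl_Suc' intro!: mult_right_le_one_le prod_nonneg)
qed

lemma F_prod_bounds: "0 \<le> F_prod \<delta> c x" "F_prod \<delta> c x \<le> 1"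
  using F_prod_le_partial[of \<delta> c x 0]
  by (auto intro!: LIMSEQ_le_const[OF F_prod_LIMSEQ] partial_prod_bounds)

lemma F_prod_mono:
  assumes "c \<le> c'" "x - \<delta> \<le> x' - \<delta>'"
  shows "F_prod \<delta> c x \<le> F_prod \<delta>' c' x'"
proof (rule LIMSEQ_le[OF F_prod_LIMSEQ F_prod_LIMSEQ])
  have "x + c * real i - \<delta> \<le> x' + c' * real i - \<delta>'" for i
    using assms mult_right_mono[of c c' "real i"] by simp
  then show "\<exists>N. \<forall>n\<ge>N. (\<Prod>i=1..n. F (x + c * real i - \<delta>))
      \<le> (\<Prod>i=1..n. F (x' + c' * real i - \<delta>'))"
    by (auto intro!: prod_mono F_mono F_bounds)
qed

text \<open>Reduces the dependence on the threshold to a single monotone function of one real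
  variable.\<close>

lemma F_prod_shift: "F_prod \<delta> c x = F_prod 0 c (x - \<delta>)"
  by (intro antisym F_prod_mono) auto

lemma F_prod_measurable [measurable]: "F_prod \<delta> c \<in> borel_measurable borel"
  by (rule borel_measurable_LIMSEQ_real[OF F_prod_LIMSEQ]) measurable

lemma F_prod_split:
  "F_prod \<delta> c x = (\<Prod>i=1..N. F (x + c * real i - \<delta>)) * F_prod \<delta> c (x + c * real N)"
proof (rule LIMSEQ_unique)
  show "(\<lambda>n. \<Prod>i=1..n+N. F (x + c * real i - \<delta>)) \<longlonglongrightarrow> F_prod \<delta> c x"
    by (rule LIMSEQ_ignore_initial_segment[OF F_prod_LIMSEQ])
  have "(\<Prod>i=1..n+N. F (x + c * real i - \<delta>))
      = (\<Prod>i=1..N. F (x + c * real i - \<delta>)) * (\<Prod>i=1..n. F (x + c * real N + c * real i - \<delta>))" for n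
    by (induction n) (simp_all add: algebra_simps)
  then show "(\<lambda>n. \<Prod>i=1..n+N. F (x + c * real i - \<delta>))
      \<longlonglongrightarrow> (\<Prod>i=1..N. F (x + c * real i - \<delta>)) * F_prod \<delta> c (x + c * real N)"
    by (simp only:) (intro tendsto_mult tendsto_const F_prod_LIMSEQ)
qed

text \<open>Index \<open>2 * k\<close> contributes the argument \<open>x + 2 * d * k\<close>, and
  index \<open>2 * k - 1\<close> the argument \<open>x - d + 2 * d * k\<close>; hence the shift by
  \<open>d\<close> in the second product.\<close>

lemma F_prod_even_odd: "F_prod \<delta> d x = F_prod \<delta> (2 * d) x * F_prod \<delta> (2 * d) (x - d)"
proof (rule LIMSEQ_unique)
  show "(\<lambda>n. \<Prod>i=1..2*n. F (x + d * real i - \<delta>)) \<longlonglongrightarrow> F_prod \<delta> d x"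
    using LIMSEQ_subseq_LIMSEQ[OF F_prod_LIMSEQ, of "\<lambda>n. 2 * n"] by (simp add: strict_mono_def o_def)
  have "(\<Prod>i=1..2*n. F (x + d * real i - \<delta>))
      = (\<Prod>i=1..n. F (x + 2 * d * real i - \<delta>)) * (\<Prod>i=1..n. F (x - d + 2 * d * real i - \<delta>))" for n
    by (induction n) (simp_all add: algebra_simps)
  then show "(\<lambda>n. \<Prod>i=1..2*n. F (x + d * real i - \<delta>))
      \<longlonglongrightarrow> F_prod \<delta> (2 * d) x * F_prod \<delta> (2 * d) (x - d)"
    by (simp only:) (intro tendsto_mult F_prod_LIMSEQ)
qed

text \<open>Dividing a positive product by its partial products leaves tails that tend to 1. These
  tails are the values along \<open>x + c * real n\<close>, and monotonicity extends the limit to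
  all large arguments.\<close>

lemma F_prod_tendsto_1:
  assumes "c > 0" "F_prod \<delta> c x > 0"
  shows "(F_prod \<delta> c \<longlongrightarrow> 1) at_top"
proof (rule order_tendstoI)
  fix a :: real assume "a < 1"
  let ?P = "\<lambda>n. \<Prod>i=1..n. F (x + c * real i - \<delta>)"
  have "(\<lambda>n. F_prod \<delta> c x / ?P n) \<longlonglongrightarrow> F_prod \<delta> c x / F_prod \<delta> c x"
    using assms by (intro tendsto_divide tendsto_const F_prod_LIMSEQ) auto
  moreover have "F_prod \<delta> c x / ?P n = F_prod \<delta> c (x + c * real n)" for n
  proof -
    have "0 < ?P n"
      by (rule less_le_trans[OF assms(2) F_prod_le_partial])
    then have "?P n \<noteq> 0"
      by (rule order.strict_implies_not_eq[symmetric])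
    then show ?thesis
      using F_prod_split[of \<delta> c x n] by (simp add: divide_eq_eq mult.commute)
  qed
  ultimately have "(\<lambda>n. F_prod \<delta> c (x + c * real n)) \<longlonglongrightarrow> 1"
    using assms by simp
  then obtain N where N: "a < F_prod \<delta> c (x + c * real N)"
    using order_tendstoD(1)[OF _ \<open>a < 1\<close>] eventually_happens'[OF sequentially_bot] by blast
  show "\<forall>\<^sub>F s in at_top. a < F_prod \<delta> c s"
    using eventually_ge_at_top[of "x + c * real N"]
    by eventually_elim (rule less_le_trans[OF N F_prod_mono], auto)
qed (intro always_eventually allI le_less_trans[OF F_prod_bounds(2)])

section \<open>Continuity of the product in drift and threshold\<close>

lemma F_prod_upper_semicontinuous:
  assumes "F_prod \<delta> c x < a"
  shows "\<forall>\<^sub>F c' in at c. F_prod \<delta> c' x < a"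
proof -
  obtain n where n: "(\<Prod>i=1..n. F (x + c * real i - \<delta>)) < a"
    using order_tendstoD(2)[OF F_prod_LIMSEQ assms] eventually_happens'[OF sequentially_bot] by blast
  have "isCont (\<lambda>c. \<Prod>i=1..n. F (x + c * real i - \<delta>)) c"
    by (intro continuous_intros)
  then have "\<forall>\<^sub>F c' in at c. (\<Prod>i=1..n. F (x + c' * real i - \<delta>)) < a"
    using n unfolding isCont_def by (rule order_tendstoD(2))
  then show ?thesis
    by eventually_elim (rule le_less_trans[OF F_prod_le_partial])
qed

lemma F_prod_tendsto_at_right: "((\<lambda>c. F_prod \<delta> c x) \<longlongrightarrow> F_prod \<delta> c x) (at_right c)"
proof (rule order_tendstoI)
  fix a assume "a < F_prod \<delta> c x"
  then have "a < F_prod \<delta> c' x" if "c < c'" for c'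
    using F_prod_mono[of c c' x \<delta> x \<delta>] that by simp
  then show "\<forall>\<^sub>F c' in at_right c. a < F_prod \<delta> c' x"
    by (auto simp: eventually_at_filter)
next
  fix a assume "F_prod \<delta> c x < a"
  then show "\<forall>\<^sub>F c' in at_right c. F_prod \<delta> c' x < a"
    using F_prod_upper_semicontinuous eventually_at_split by blast
qed

lemma F_prod_isCont_drift:
  assumes "c > 0"
  shows "isCont (\<lambda>c. F_prod \<delta> c x) c"
  unfolding isCont_def
proof (rule order_tendstoI)
  fix a assume a: "a < F_prod \<delta> c x"
  show "\<forall>\<^sub>F c' in at c. a < F_prod \<delta> c' x"
  \<comment> \<open>If \<open>a \<ge> 0\<close>, the product at \<open>c\<close> is positive, as
    \<open>F_prod_tendsto_1\<close> demands.\<close>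
  proof (cases "a < 0")
    case True
    then show ?thesis
      by (intro always_eventually allI less_le_trans[OF _ F_prod_bounds(1)])
  next
    case False
    let ?P = "\<lambda>c n. \<Prod>i=1..n. F (x + c * real i - \<delta>)"
    \<comment> \<open>Any drift below \<open>c\<close> bounds the nearby drifts from below; exactly
      half of \<open>c\<close> makes \<open>F_prod_even_odd\<close> lead back to drift
      \<open>c\<close>.\<close>
    define d where "d = c / 2"
    have d: "0 < d" "d < c" "2 * d = c"
      using assms by (auto simp: d_def)
    have lim: "(F_prod \<delta> c \<longlongrightarrow> 1) at_top"
      using F_prod_tendsto_1[of c \<delta> x] assms a False by simp
    have at_top: "filterlim (\<lambda>n. x + d * real n + s) at_top sequentially" for s
      using d(1) by real_asymp
    have "(\<lambda>n. F_prod \<delta> d (x + d * real n)) \<longlonglongrightarrow> 1 * 1"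
      unfolding F_prod_even_odd[of \<delta> d] d(3)
      using filterlim_compose[OF lim at_top[of 0]] filterlim_compose[OF lim at_top[of "- d"]]
      by (intro tendsto_mult) auto
    then have "(\<lambda>n. ?P c n * F_prod \<delta> d (x + d * real n)) \<longlonglongrightarrow> F_prod \<delta> c x * (1 * 1)"
      by (intro tendsto_mult F_prod_LIMSEQ)
    then have "\<forall>\<^sub>F n in sequentially. a < ?P c n * F_prod \<delta> d (x + d * real n)"
      using a by (auto dest: order_tendstoD(1))
    then obtain N where N: "a < ?P c N * F_prod \<delta> d (x + d * real N)"
      using eventually_happens'[OF sequentially_bot] by blast
    \<comment> \<open>With \<open>N\<close> and the tail for drift \<open>d\<close> fixed, only
      finitely many factors vary with the drift.\<close>
    have "isCont (\<lambda>c. ?P c N * F_prod \<delta> d (x + d * real N)) c"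
      by (intro continuous_intros)
    then have "\<forall>\<^sub>F c' in at c. a < ?P c' N * F_prod \<delta> d (x + d * real N)"
      using N unfolding isCont_def by (rule order_tendstoD(1))
    moreover have "\<forall>\<^sub>F c' in at c. d < c'"
      using order_tendstoD(1)[OF tendsto_ident_at d(2)] .
    ultimately show ?thesis
    proof eventually_elim
      case (elim c')
      \<comment> \<open>Since \<open>d < c'\<close>, replacing \<open>d\<close> by \<open>c'\<close>
        raises both the drift and the starting point of the tail.\<close>
      have "?P c' N * F_prod \<delta> d (x + d * real N) \<le> ?P c' N * F_prod \<delta> c' (x + c' * real N)"
        using elim(2) by (intro mult_left_mono F_prod_mono partial_prod_bounds)
          (auto intro: mult_right_mono)
      then show ?case
        using elim(1) F_prod_split[of \<delta> c' x N] by simp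
    qed
  qed
qed (rule F_prod_upper_semicontinuous)

text \<open>The exceptional \<open>x\<close> are the countably many discontinuities of
  \<open>F_prod 0 c\<close>, shifted by \<open>\<delta>\<close>. This null set may depend on
  \<open>\<delta>\<close>, since continuity of the integral is proved at one \<open>\<delta>\<close>
  at a time.\<close>

lemma AE_F_prod_isCont_threshold: "AE x in lborel. isCont (\<lambda>\<delta>. F_prod \<delta> c x) \<delta>"
proof -
  let ?A = "{t. \<not> isCont (F_prod 0 c) t}"
  have "countable ?A"
    by (intro mono_ctble_discont monoI F_prod_mono) auto
  then have "countable ((\<lambda>t. t + \<delta>) ` ?A)"
    by (rule countable_image)
  then have "AE x in lborel. x \<notin> (\<lambda>t. t + \<delta>) ` ?A"
    by (intro AE_not_in countable_imp_null_set_lborel)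
  then show ?thesis
  proof eventually_elim
    case (elim x)
    then have "isCont (F_prod 0 c) (x - \<delta>)"
      by (force simp: image_iff)
    then have "isCont (\<lambda>\<delta>. F_prod 0 c (x - \<delta>)) \<delta>"
      by (rule isCont_o2[rotated]) (intro continuous_intros)
    then show ?case
      by (subst F_prod_shift)
  qed
qed

section \<open>The product for negative and zero drift\<close>

lemma F_prod_neg_drift:
  assumes "c < 0"
  shows "F_prod \<delta> c x = 0"
proof (rule antisym)
  have "filterlim (\<lambda>n. x + c * real (Suc n) - \<delta>) at_bot sequentially"
    using assms by real_asymp
  then have "(\<lambda>n. F (x + c * real (Suc n) - \<delta>)) \<longlonglongrightarrow> 0"
    unfolding F_eq by (rule filterlim_compose[OF D.cdf_lim_at_bot])
  \<comment> \<open>The last factor alone bounds each partial product, the others being at most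
    1.\<close>
  moreover have "F_prod \<delta> c x \<le> F (x + c * real (Suc n) - \<delta>)" for n
  proof -
    have "(\<Prod>i=1..n. F (x + c * real i - \<delta>)) * F (x + c * real (Suc n) - \<delta>)
        \<le> F (x + c * real (Suc n) - \<delta>)"
      by (intro mult_left_le_one_le F_bounds partial_prod_bounds)
    then show ?thesis
      using F_prod_le_partial[of \<delta> c x "Suc n"] by simp
  qed
  ultimately show "F_prod \<delta> c x \<le> 0"
    by (intro LIMSEQ_le_const) auto
qed (rule F_prod_bounds)

lemma F_prod_no_drift: "F_prod \<delta> 0 x = (if x_plus \<le> ereal (x - \<delta>) then 1 else 0)"
proof -
  have "(\<lambda>n. F (x - \<delta>) ^ n) \<longlonglongrightarrow> F_prod \<delta> 0 x"
    using F_prod_LIMSEQ[of x 0 \<delta>] by simp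
  moreover have "(\<lambda>n. F (x - \<delta>) ^ n) \<longlonglongrightarrow> (if F (x - \<delta>) = 1 then 1 else 0)"
    using F_bounds[of "x - \<delta>"] by (auto intro: LIMSEQ_power_zero)
  ultimately show ?thesis
    unfolding F_eq_1_iff by (rule LIMSEQ_unique)
qed

section \<open>Continuity of the asymptotic record probability\<close>

lemma asymptotic_delta_record_prob_tendsto:
  assumes "AE x in lborel. ((\<lambda>u. F_prod (D u) (C u) x) \<longlongrightarrow> F_prod (D u0) (C u0) x) (at u0 within S)"
  shows "((\<lambda>u::real. asymptotic_delta_record_prob M X (D u) (C u))
    \<longlongrightarrow> asymptotic_delta_record_prob M X (D u0) (C u0)) (at u0 within S)"
  unfolding tendsto_at_iff_sequentially asymptotic_delta_record_prob_eq o_def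
\<comment> \<open>Dominated convergence, with majorant \<open>f\<close>, applies along sequences.
  The paths \<open>D\<close> and \<open>C\<close> allow either parameter to vary.\<close>
proof (intro allI impI)
  fix v assume v: "\<forall>i. v i \<in> S - {u0}" "v \<longlonglongrightarrow> u0"
  show "(\<lambda>n. \<integral>x. F_prod (D (v n)) (C (v n)) x * f x \<partial>lborel)
      \<longlonglongrightarrow> (\<integral>x. F_prod (D u0) (C u0) x * f x \<partial>lborel)"
  proof (rule integral_dominated_convergence[where w = f])
    show "AE x in lborel. (\<lambda>n. F_prod (D (v n)) (C (v n)) x * f x) \<longlonglongrightarrow> F_prod (D u0) (C u0) x * f x"
      using assms
    proof eventually_elim
      case (elim x)
      then show ?case
        using v by (intro tendsto_mult tendsto_const) (simp add: tendsto_at_iff_sequentially o_def)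
    qed
    show "AE x in lborel. norm (F_prod (D (v n)) (C (v n)) x * f x) \<le> f x" for n
      by (auto simp: abs_mult f_nonneg F_prod_bounds intro!: mult_left_le_one_le)
  qed (simp_all add: f_integrable)
qed

lemma asymptotic_delta_record_prob_neg_drift:
  "c < 0 \<Longrightarrow> asymptotic_delta_record_prob M X \<delta> c = 0"
  by (simp add: asymptotic_delta_record_prob_eq F_prod_neg_drift)

text \<open>The value is the mass that \<open>f\<close> places on
  \<open>x \<ge> x_plus + \<delta>\<close>, which is positive exactly when this half-line meets the
  support below a finite \<open>x_plus\<close>.\<close>

lemma asymptotic_delta_record_prob_no_drift_eq_0_iff:
  "asymptotic_delta_record_prob M X \<delta> 0 = 0 \<longleftrightarrow> \<not> (x_plus < \<infinity> \<and> \<delta> < 0)"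
proof
  assume "asymptotic_delta_record_prob M X \<delta> 0 = 0"
  moreover have "integrable lborel (\<lambda>x. F_prod \<delta> 0 x * f x)"
    by (rule Bochner_Integration.integrable_bound[OF f_integrable])
       (auto simp: abs_mult f_nonneg F_prod_bounds intro!: mult_left_le_one_le)
  ultimately have AE: "AE x in lborel. F_prod \<delta> 0 x * f x = 0"
    by (simp add: asymptotic_delta_record_prob_eq integral_nonneg_eq_0_iff_AE F_prod_bounds f_nonneg)
  show "\<not> (x_plus < \<infinity> \<and> \<delta> < 0)"
  proof
    assume *: "x_plus < \<infinity> \<and> \<delta> < 0"
    with endpoints obtain b where b: "x_plus = ereal b"
      by (cases x_plus) auto
    have "AE x in lborel. \<not> (max x_minus (ereal (b + \<delta>)) < ereal x \<and> ereal x < x_plus)"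
      using AE
    proof eventually_elim
      case (elim x)
      then show ?case
        using f_pos[of x] by (auto simp: F_prod_no_drift b split: if_splits)
    qed
    then show False
      using not_AE_lborel_outside_interval[of "max x_minus (ereal (b + \<delta>))" x_plus] endpoints * b
      by simp
  qed
next
  assume *: "\<not> (x_plus < \<infinity> \<and> \<delta> < 0)"
  \<comment> \<open>Where \<open>f x\<close> is nonzero, \<open>x < x_plus\<close>; then also
    \<open>x - \<delta> < x_plus\<close>, because \<open>\<delta> \<ge> 0\<close> or
    \<open>x_plus\<close> is infinite.\<close>
  have "F_prod \<delta> 0 x * f x = 0" for x
    using * f_zero[of x] by (cases x_plus) (auto simp: F_prod_no_drift)
  then show "asymptotic_delta_record_prob M X \<delta> 0 = 0"
    by (simp only: asymptotic_delta_record_prob_eq integral_zero)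
qed

lemma isCont_asymptotic_delta_record_prob_drift:
  assumes "c \<noteq> 0"
  shows "isCont (asymptotic_delta_record_prob M X \<delta>) c"
proof (cases "c < 0")
  case True
  then have "\<forall>\<^sub>F c in nhds c. asymptotic_delta_record_prob M X \<delta> c = 0"
    using eventually_nhds_in_open[of "{..<0}" c]
    by (auto elim!: eventually_mono simp: asymptotic_delta_record_prob_neg_drift)
  then show ?thesis
    by (subst isCont_cong) auto
next
  case False
  with assms show ?thesis
    unfolding isCont_def
    using F_prod_isCont_drift[of c \<delta>]
    by (intro asymptotic_delta_record_prob_tendsto[where D = "\<lambda>_. \<delta>" and C = "\<lambda>c. c"] AE_I2)
       (simp add: isCont_def)
qed

lemma asymptotic_delta_record_prob_tendsto_at_right:
  "(asymptotic_delta_record_prob M X \<delta> \<longlongrightarrow> asymptotic_delta_record_prob M X \<delta> c) (at_right c)"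
  by (intro asymptotic_delta_record_prob_tendsto[where D = "\<lambda>_. \<delta>" and C = "\<lambda>c. c"] AE_I2
      F_prod_tendsto_at_right)

text \<open>The left limit at 0 is 0 and the right limit is the value at 0, so the two agree exactly
  when that value vanishes.\<close>

lemma isCont_asymptotic_delta_record_prob_no_drift_iff:
  "isCont (asymptotic_delta_record_prob M X \<delta>) 0 \<longleftrightarrow> asymptotic_delta_record_prob M X \<delta> 0 = 0"
proof -
  have "\<forall>\<^sub>F c in at_left 0. 0 = asymptotic_delta_record_prob M X \<delta> c"
    by (auto simp: eventually_at_filter asymptotic_delta_record_prob_neg_drift)
  then have left: "(asymptotic_delta_record_prob M X \<delta> \<longlongrightarrow> 0) (at_left 0)"
    by (rule Lim_transform_eventually[OF tendsto_const])
  show ?thesis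
    unfolding isCont_def filterlim_at_split
    using left asymptotic_delta_record_prob_tendsto_at_right[of \<delta> 0]
      tendsto_unique[OF trivial_limit_at_left_real left] by force
qed

lemma isCont_asymptotic_delta_record_prob_threshold:
  "isCont (\<lambda>\<delta>. asymptotic_delta_record_prob M X \<delta> c) \<delta>"
  unfolding isCont_def
  by (rule asymptotic_delta_record_prob_tendsto[where D = "\<lambda>\<delta>. \<delta>" and C = "\<lambda>_. c"])
     (rule AE_F_prod_isCont_threshold[unfolded isCont_def])

end

theorem theorem2:
  fixes M :: "'a measure"
    and X :: "nat \<Rightarrow> 'a \<Rightarrow> real"
    and f :: "real \<Rightarrow> real"
    and x_minus x_plus :: ereal
  assumes "linear_drift_model M X f x_minus x_plus"
  shows "(\<forall>\<delta>. (\<forall>c. c \<noteq> 0 \<longrightarrow> isCont (\<lambda>c. asymptotic_delta_record_prob M X \<delta> c) c)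
              \<and> continuous (at_right 0) (\<lambda>c. asymptotic_delta_record_prob M X \<delta> c))
       \<and> (\<forall>\<delta>. \<not> isCont (\<lambda>c. asymptotic_delta_record_prob M X \<delta> c) 0
              \<longleftrightarrow> x_plus < \<infinity> \<and> \<delta> < 0)
       \<and> (\<forall>c. continuous_on UNIV (\<lambda>\<delta>. asymptotic_delta_record_prob M X \<delta> c))"
proof -
  interpret linear_drift_model M X f x_minus x_plus
    by (rule assms)
  show ?thesis
    using isCont_asymptotic_delta_record_prob_drift asymptotic_delta_record_prob_tendsto_at_right[of _ 0]
      isCont_asymptotic_delta_record_prob_no_drift_iff asymptotic_delta_record_prob_no_drift_eq_0_iff
      isCont_asymptotic_delta_record_prob_threshold
    by (simp only: continuous_within continuous_on_eq_continuous_at[OF open_UNIV]) blast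
qed

end
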